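(* For every $f(z)=z+\sum_{k\ge 2}a_kz^k$ in $K$ (put $a_1=1$) and all positive integers $k,m$, $$\Bigl|k|a_k|-m|a_m|\Bigr|\le |k^2-m^2|.$$
   Context: Let $E=\{z\in\mathbb{C}:|z|<1\}$ and let $A$ be the class of functions $f(z)=z+a_2z^2+\cdots$ analytic in $E$. A function $g(z)=z+b_2z^2+\cdots$ in $A$ is convex if $\operatorname{Re}\left(1+\frac{zg''(z)}{g'(z)}\right)>0$ for all $z\in E$. A function $f\in A$ is close-to-convex in $E$ if there is a convex function $g(z)=z+b_2z^2+\cdots$ in $A$ with $\operatorname{Re}\frac{f'(z)}{g'(z)}>0$ for all $z\in E$. The class of close-to-convex functions in this sense is denoted by $K$. *)

theory Defs
  imports "HOL-Complex_Analysis.Complex_Analysis"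
begin

abbreviation unit_disc :: "complex set" where
  "unit_disc \<equiv> ball 0 1"

definition taylor_coeff :: "(complex \<Rightarrow> complex) \<Rightarrow> nat \<Rightarrow> complex" where
  "taylor_coeff f k = fps_nth (fps_expansion f 0) k"

definition class_A :: "(complex \<Rightarrow> complex) set" where
  "class_A = {f. f holomorphic_on unit_disc \<and> taylor_coeff f 0 = 0 \<and> taylor_coeff f 1 = 1}"

(* The condition deriv g z \<noteq> 0 makes the quotient meaningful: division by zero
   yields 0, so the real part would otherwise be 1 at a critical point of g. *)
definition convex_function :: "(complex \<Rightarrow> complex) \<Rightarrow> bool" where
  "convex_function g \<longleftrightarrow> g \<in> class_A \<and>
     (\<forall>z\<in>unit_disc. deriv g z \<noteq> 0 \<and> Re (1 + z * deriv (deriv g) z / deriv g z) > 0)"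

(* The comparison function g is normalised (g 0 = 0 and deriv g 0 = 1); no
   rotation factor is allowed, unlike in the more general notion of close-to-convexity. *)
definition class_K :: "(complex \<Rightarrow> complex) set" where
  "class_K = {f \<in> class_A. \<exists>g. convex_function g \<and>
     (\<forall>z\<in>unit_disc. Re (deriv f z / deriv g z) > 0)}"

end

theory Submission
  imports Defs
begin

text \<open>
  It suffices to treat consecutive indices. Write \<open>b\<^sub>k = k a\<^sub>k\<close>, \<open>P = f'/g'\<close> and
  \<open>p = 1 + z g''/g'\<close>, so that \<open>P\<close> and \<open>p\<close> have positive real part. For \<open>\<bar>\<zeta>\<bar> = 1\<close> the number
  \<open>b\<^sub>n\<^sub>+\<^sub>1 - \<zeta> b\<^sub>n\<close> is the \<open>n\<close>th coefficient of \<open>(1 - \<zeta> z) g' P\<close>; with \<open>d\<^sub>k\<close> the coefficients of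
  \<open>(1 - \<zeta> z) g'\<close> and Caratheodory's bound \<open>\<bar>P\<^sub>k\<bar> \<le> 2\<close> it is at most
  \<open>\<bar>d\<^sub>n\<bar> + 2 (\<bar>d\<^sub>0\<bar> + \<dots> + \<bar>d\<^sub>n\<^sub>-\<^sub>1\<bar>)\<close>. An inequality of Lebedev-Milin type bounds the same combination
  of the \<open>\<bar>d\<^sub>k\<bar>\<^sup>2\<close> by \<open>(2n + 1) exp X\<close>, where \<open>X\<close> is a linear combination of the
  \<open>\<bar>p\<^sub>j - \<zeta>\<^sup>j\<bar>\<^sup>2 - 1\<close>. Averaging over \<open>\<zeta>\<close> against the Herglotz measure of \<open>p\<close> shows that some \<open>\<zeta>\<close>
  makes \<open>X \<le> 0\<close>.
\<close>

section \<open>Functions with nonnegative real part in the disc\<close>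

text \<open>This stands in for the Herglotz representation: the conclusion says that the Herglotz
  measure of \<open>q\<close> integrates a nonnegative trigonometric polynomial to a nonnegative
  number. Circle means of radius r < 1 replace the measure, so that no weak limit is
  required.\<close>

lemma trigonometric_pairing_nonneg:
  fixes q :: "complex \<Rightarrow> complex" and a :: real and e :: "nat \<Rightarrow> complex"
  assumes holo: "q holomorphic_on ball 0 1"
    and Re_q: "\<And>z. z \<in> ball 0 1 \<Longrightarrow> Re (q z) \<ge> 0"
    and nonneg: "\<And>z. cmod z = 1 \<Longrightarrow> a + 2 * (\<Sum>k=1..n. Re (e k * z ^ k)) \<ge> 0"
  shows "a * Re (q 0) + (\<Sum>k=1..n. Re (cnj (e k) * fps_nth (fps_expansion q 0) k)) \<ge> 0"
proof -
  define Q where "Q = fps_nth (fps_expansion q 0)"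
  \<comment> \<open>Since \<open>q\<close> need not extend to the closed disc, the means are taken
    on smaller circles, which costs the damping factors \<open>r ^ k\<close>; these disappear as r
    tends to 1.\<close>
  have at_radius: "a * Re (q 0) + (\<Sum>k=1..n. r ^ k * Re (cnj (e k) * Q k)) \<ge> 0"
    if r: "0 < r" "r < 1" for r :: real
  proof -
    have holo_r: "q holomorphic_on cball 0 r"
      using holo by (rule holomorphic_on_subset) (use r in auto)
    have neg_powers: "((\<lambda>z. q z / z ^ Suc k) has_contour_integral 2 * pi * \<i> * Q k) (circlepath 0 r)" for k
    proof -
      have "((\<lambda>z. q z / (z - 0) ^ Suc k) has_contour_integral
              (2 * pi * \<i>) / fact k * (deriv ^^ k) q 0) (circlepath 0 r)"
        using r holo_r
        by (intro Cauchy_has_contour_integral_higher_derivative_circlepath)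
           (auto intro: holomorphic_on_imp_continuous_on holomorphic_on_subset)
      then show ?thesis by (simp add: Q_def fps_expansion_def mult_ac)
    qed
    have pos_powers: "((\<lambda>z. q z * z ^ k) has_contour_integral 0) (circlepath 0 r)" for k
    proof (rule Cauchy_theorem_convex_simple[where S = "ball 0 1"])
      show "(\<lambda>z. q z * z ^ k) holomorphic_on ball 0 1"
        by (intro holomorphic_intros holo)
    qed (use r in auto)
    \<comment> \<open>On the circle of radius r, \<open>r / z\<close> is the conjugate of
      \<open>z / r\<close>. Writing the conjugate this way turns the trigonometric polynomial into a
      Laurent polynomial, so contour integrals apply: positive powers of z contribute nothing, and
      negative powers extract the coefficients \<open>Q k\<close>.\<close>
    define \<tau> where "\<tau> z = of_real a + (\<Sum>k=1..n. e k * (z / r) ^ k + cnj (e k) * (r / z) ^ k)" for z :: complex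
    have "((\<lambda>z. of_real a * (q z / z ^ Suc 0) +
             (\<Sum>k=1..n. e k / r ^ k * (q z * z ^ (k - 1)) + cnj (e k) * r ^ k * (q z / z ^ Suc k)))
          has_contour_integral of_real a * (2 * pi * \<i> * Q 0) +
             (\<Sum>k=1..n. e k / r ^ k * 0 + cnj (e k) * r ^ k * (2 * pi * \<i> * Q k))) (circlepath 0 r)"
      by (intro has_contour_integral_add has_contour_integral_lmul has_contour_integral_sum
            neg_powers pos_powers) auto
    moreover have "of_real a * (q z / z ^ Suc 0) +
             (\<Sum>k=1..n. e k / r ^ k * (q z * z ^ (k - 1)) + cnj (e k) * r ^ k * (q z / z ^ Suc k))
             = \<tau> z * q z / z" if "z \<in> path_image (circlepath 0 r)" for z :: complex
    proof -
      have z: "z \<noteq> 0" using that r by auto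
      have "e k / r ^ k * (q z * z ^ (k - 1)) + cnj (e k) * r ^ k * (q z / z ^ Suc k)
            = (e k * (z / r) ^ k + cnj (e k) * (r / z) ^ k) * (q z / z)" if "k \<in> {1..n}" for k
      proof -
        obtain j where "k = Suc j" using \<open>k \<in> {1..n}\<close> by (cases k) auto
        then show ?thesis using z r by (simp add: power_divide field_simps)
      qed
      then have sums: "(\<Sum>k=1..n. e k / r ^ k * (q z * z ^ (k - 1)) + cnj (e k) * r ^ k * (q z / z ^ Suc k))
            = (\<Sum>k=1..n. e k * (z / r) ^ k + cnj (e k) * (r / z) ^ k) * (q z / z)"
        unfolding sum_distrib_right by (rule sum.cong[OF refl])
      show ?thesis
        unfolding \<tau>_def sums by (simp add: distrib_right add_divide_distrib)
    qed
    ultimately have "((\<lambda>z. \<tau> z * q z / z) has_contour_integral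
        of_real a * (2 * pi * \<i> * Q 0) +
             (\<Sum>k=1..n. e k / r ^ k * 0 + cnj (e k) * r ^ k * (2 * pi * \<i> * Q k))) (circlepath 0 r)"
      by (rule has_contour_integral_eq)
    also have "of_real a * (2 * pi * \<i> * Q 0) +
             (\<Sum>k=1..n. e k / r ^ k * 0 + cnj (e k) * r ^ k * (2 * pi * \<i> * Q k))
        = 2 * pi * \<i> * (of_real a * Q 0 + (\<Sum>k=1..n. r ^ k * (cnj (e k) * Q k)))"
      by (simp add: distrib_left sum_distrib_left mult_ac)
    finally have "((\<lambda>z. \<tau> z * q z / z) has_contour_integral
        2 * pi * \<i> * (of_real a * Q 0 + (\<Sum>k=1..n. r ^ k * (cnj (e k) * Q k)))) (circlepath 0 r)"
      .
    then have "((\<lambda>t. \<tau> (circlepath 0 r t) * q (circlepath 0 r t) / circlepath 0 r t *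
         vector_derivative (circlepath 0 r) (at t within {0..1})) has_integral
        2 * pi * \<i> * (of_real a * Q 0 + (\<Sum>k=1..n. r ^ k * (cnj (e k) * Q k)))) {0..1}"
      by (simp add: has_contour_integral_def)
    \<comment> \<open>On the circle dz / z = 2 pi i dt, so the contour integral becomes an ordinary
      mean over t.\<close>
    then have "((\<lambda>t. 2 * pi * \<i> * (\<tau> (circlepath 0 r t) * q (circlepath 0 r t))) has_integral
        2 * pi * \<i> * (of_real a * Q 0 + (\<Sum>k=1..n. r ^ k * (cnj (e k) * Q k)))) {0..1}"
    proof (rule has_integral_eq[rotated])
      fix t :: real assume "t \<in> {0..1}"
      then have "vector_derivative (circlepath 0 r) (at t within {0..1}) = 2 * pi * \<i> * circlepath 0 r t"
        by (simp add: vector_derivative_circlepath01) (simp add: circlepath)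
      moreover have "circlepath 0 r t \<noteq> 0" using r by (simp add: circlepath)
      ultimately show "\<tau> (circlepath 0 r t) * q (circlepath 0 r t) / circlepath 0 r t *
           vector_derivative (circlepath 0 r) (at t within {0..1})
         = 2 * pi * \<i> * (\<tau> (circlepath 0 r t) * q (circlepath 0 r t))"
        by simp
    qed
    then have "((\<lambda>t. inverse (2 * pi * \<i>) * (2 * pi * \<i> * (\<tau> (circlepath 0 r t) * q (circlepath 0 r t)))) has_integral
        inverse (2 * pi * \<i>) * (2 * pi * \<i> * (of_real a * Q 0 + (\<Sum>k=1..n. r ^ k * (cnj (e k) * Q k))))) {0..1}"
      by (rule has_integral_mult_right)
    moreover have "inverse (2 * pi * \<i>) * (2 * pi * \<i> * x) = x" for x
      by (subst mult.assoc[symmetric], subst left_inverse) simp_all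
    ultimately have "((\<lambda>t. \<tau> (circlepath 0 r t) * q (circlepath 0 r t)) has_integral
        (of_real a * Q 0 + (\<Sum>k=1..n. r ^ k * (cnj (e k) * Q k)))) {0..1}"
      by (simp only:)
    from has_integral_linear[OF this bounded_linear_Re]
    have "((\<lambda>t. Re (\<tau> (circlepath 0 r t) * q (circlepath 0 r t))) has_integral
        Re (of_real a * Q 0 + (\<Sum>k=1..n. r ^ k * (cnj (e k) * Q k)))) {0..1}"
      by (simp only: o_def)
    \<comment> \<open>On the circle \<tau> takes real nonnegative values, so multiplying by it
      preserves the sign of \<open>Re (q z)\<close>.\<close>
    moreover have "Re (\<tau> z * q z) \<ge> 0" if z: "cmod z = r" for z :: complex
    proof -
      have unit: "cmod (z / r) = 1" using z r by (simp add: norm_divide)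
      have conj: "r / z = cnj (z / r)"
        using unit by (metis complex_div_cnj divide_divide_eq_right div_by_1 inverse_divide
            inverse_eq_divide mult_1 of_real_1 power_one)
      have "\<tau> z = of_real (a + 2 * (\<Sum>k=1..n. Re (e k * (z / r) ^ k)))"
      proof -
        have "e k * (z / r) ^ k + cnj (e k) * (r / z) ^ k = of_real (2 * Re (e k * (z / r) ^ k))" for k
          unfolding conj using complex_add_cnj[of "e k * (z / r) ^ k"] by simp
        then show ?thesis by (simp add: \<tau>_def sum_distrib_left)
      qed
      then have "Re (\<tau> z * q z) = (a + 2 * (\<Sum>k=1..n. Re (e k * (z / r) ^ k))) * Re (q z)"
        by (simp only: times_complex.simps Re_complex_of_real Im_complex_of_real mult_zero_left diff_zero)
      then show ?thesis
        using nonneg[OF unit] Re_q[of z] z r by simp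
    qed
    ultimately have "Re (of_real a * Q 0 + (\<Sum>k=1..n. r ^ k * (cnj (e k) * Q k))) \<ge> 0"
      by (rule has_integral_nonneg)
         (use r in \<open>auto simp: circlepath norm_mult\<close>)
    then show ?thesis
      unfolding Re_sum plus_complex.simps of_real_power[symmetric] times_complex.simps Re_complex_of_real Im_complex_of_real mult_zero_left diff_zero
      by (simp add: Q_def fps_expansion_def)
  qed
  have "((\<lambda>r. a * Re (q 0) + (\<Sum>k=1..n. r ^ k * Re (cnj (e k) * Q k)))
      \<longlongrightarrow> a * Re (q 0) + (\<Sum>k=1..n. 1 ^ k * Re (cnj (e k) * Q k))) (at_left 1)"
    by (intro tendsto_intros)
  moreover have "\<forall>\<^sub>F r in at_left (1::real). a * Re (q 0) + (\<Sum>k=1..n. r ^ k * Re (cnj (e k) * Q k)) \<ge> 0"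
    using eventually_at_left_real[OF zero_less_one]
    by (rule eventually_mono) (rule at_radius; simp)
  ultimately show ?thesis
    using tendsto_lowerbound[of _ _ "at_left (1::real)" 0] by (simp add: Q_def)
qed

text \<open>It suffices to test with the polynomial 1 + 2 Re (e z^k), |e| = 1/2, which is
  nonnegative on the circle.\<close>

lemma caratheodory_coeff_bound:
  fixes q :: "complex \<Rightarrow> complex"
  assumes "q holomorphic_on ball 0 1" "\<And>z. z \<in> ball 0 1 \<Longrightarrow> Re (q z) \<ge> 0" "q 0 = 1" "k \<ge> 1"
  shows "cmod (fps_nth (fps_expansion q 0) k) \<le> 2"
proof (rule ccontr)
  define c where "c = fps_nth (fps_expansion q 0) k"
  assume "\<not> ?thesis"
  then have c: "cmod c > 2" by (simp add: c_def)
  \<comment> \<open>The phase is opposite to that of \<open>c\<close>, so the pairing becomes 1 -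
    |c| / 2.\<close>
  define e where "e j = (if j = k then - c / (2 * cmod c) else 0)" for j
  have pick: "(\<Sum>j=1..k. Re (h (e j) j)) = Re (h (e k) k)" if "\<And>j. h 0 j = 0" for h :: "complex \<Rightarrow> nat \<Rightarrow> complex"
  proof -
    have "(\<Sum>j=1..k. Re (h (e j) j)) = (\<Sum>j=1..k. if j = k then Re (h (e k) k) else 0)"
      by (rule sum.cong) (auto simp: e_def that)
    then show ?thesis using \<open>k \<ge> 1\<close> by simp
  qed
  have "1 * Re (q 0) + (\<Sum>j=1..k. Re (cnj (e j) * fps_nth (fps_expansion q 0) j)) \<ge> 0"
  proof (rule trigonometric_pairing_nonneg[OF assms(1,2)])
    fix z :: complex assume "cmod z = 1"
    then have "cmod (e k * z ^ k) = 1/2"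
      using c by (cases "c = 0") (simp_all add: e_def norm_mult norm_divide norm_power)
    then have "Re (e k * z ^ k) \<ge> - 1/2"
      using abs_Re_le_cmod[of "e k * z ^ k"] by linarith
    then show "1 + 2 * (\<Sum>j=1..k. Re (e j * z ^ j)) \<ge> 0"
      using pick[of "\<lambda>x j. x * z ^ j"] by simp
  qed auto
  then have "1 + Re (cnj (e k) * c) \<ge> 0"
    using pick[of "\<lambda>x j. cnj x * fps_nth (fps_expansion q 0) j"] \<open>q 0 = 1\<close> by (simp add: c_def)
  moreover have "cnj (e k) * c = - of_real (cmod c / 2)"
  proof -
    have "cnj (e k) * c = - (c * cnj c) / (2 * of_real (cmod c))"
      by (simp add: e_def)
    also have "\<dots> = - of_real (cmod c / 2)"
      unfolding complex_norm_square[symmetric] using c by (auto simp: power2_eq_square)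
    finally show ?thesis .
  qed
  ultimately show False using c by simp
qed

text \<open>Expanding the squares leaves the sum of \<open>c k * (cmod (p k))\<^sup>2\<close> minus
  2 \<open>T w\<close>, where \<zeta> = \<open>cnj w\<close>. The Herglotz mean of \<open>T\<close>
  is half of that first sum, and the maximum of \<open>T\<close> on the circle is at least its
  mean.\<close>

lemma exists_rotation_nonpos:
  fixes q :: "complex \<Rightarrow> complex" and c :: "nat \<Rightarrow> real"
  assumes "q holomorphic_on ball 0 1" "\<And>z. z \<in> ball 0 1 \<Longrightarrow> Re (q z) \<ge> 0" "q 0 = 1"
  obtains \<zeta> where "cmod \<zeta> = 1"
    "(\<Sum>k=1..n. c k * ((cmod (fps_nth (fps_expansion q 0) k - \<zeta> ^ k))\<^sup>2 - 1)) \<le> 0"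
proof -
  define p where "p = fps_nth (fps_expansion q 0)"
  define T where "T z = (\<Sum>k=1..n. Re (of_real (c k) * p k * z ^ k))" for z
  obtain w where w: "cmod w = 1" "\<And>z. cmod z = 1 \<Longrightarrow> T z \<le> T w"
  proof -
    have "continuous_on (sphere 0 1) T" unfolding T_def by (intro continuous_intros)
    moreover have "sphere (0::complex) 1 \<noteq> {}" by simp
    ultimately show ?thesis
      using continuous_attains_sup[of "sphere (0::complex) 1" T] that by auto
  qed
  \<comment> \<open>The polynomial paired here is 2 (T w - T z), nonnegative because
    \<open>w\<close> is a maximum point.\<close>
  have "2 * T w * Re (q 0) + (\<Sum>k=1..n. Re (cnj (- of_real (c k) * p k) * p k)) \<ge> 0"
    unfolding p_def
  proof (rule trigonometric_pairing_nonneg[OF assms(1,2)])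
    fix z :: complex assume "cmod z = 1"
    from w(2)[OF this]
    show "2 * T w + 2 * (\<Sum>k=1..n. Re (- of_real (c k) * fps_nth (fps_expansion q 0) k * z ^ k)) \<ge> 0"
      by (simp only: T_def p_def mult_minus_left uminus_complex.simps sum_negf)
  qed auto
  moreover have "Re (cnj (- of_real (c k) * p k) * p k) = - (c k * (cmod (p k))\<^sup>2)" for k
    unfolding cmod_power2 by (simp add: algebra_simps power2_eq_square)
  ultimately have "(\<Sum>k=1..n. c k * (cmod (p k))\<^sup>2) \<le> 2 * T w"
    using assms(3) by (simp add: sum_negf)
  moreover have "c k * ((cmod (p k - cnj w ^ k))\<^sup>2 - 1)
      = c k * (cmod (p k))\<^sup>2 - 2 * Re (of_real (c k) * p k * w ^ k)" for k
  proof -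
    have "(cmod (cnj w ^ k))\<^sup>2 = 1" using w(1) by (simp add: norm_power)
    then have "(cmod (p k - cnj w ^ k))\<^sup>2 - 1 = (cmod (p k))\<^sup>2 - 2 * Re (p k * w ^ k)"
      unfolding cmod_power2 by (simp add: algebra_simps power2_eq_square flip: complex_cnj_power)
    then show ?thesis by (simp only:) (simp add: algebra_simps)
  qed
  ultimately have "(\<Sum>k=1..n. c k * ((cmod (p k - cnj w ^ k))\<^sup>2 - 1)) \<le> 0"
    by (simp add: T_def sum_subtractf sum_distrib_left)
  then show ?thesis using that[of "cnj w"] w(1) by (simp add: p_def)
qed

section \<open>Inequalities of Lebedev-Milin type\<close>

text \<open>The hypothesis compares kth coefficients in z D' = B D, where B is the series with
  coefficients \<open>\<beta> j\<close>, j \<ge> 1; Cauchy-Schwarz separates the two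
  factors.\<close>

lemma exponential_recurrence_coeff_sq:
  fixes \<beta> d :: "nat \<Rightarrow> complex"
  assumes "of_nat k * d k = (\<Sum>j=1..k. \<beta> j * d (k - j))"
  shows "(real k)\<^sup>2 * (cmod (d k))\<^sup>2 \<le> (\<Sum>j=1..k. (cmod (\<beta> j))\<^sup>2) * (\<Sum>j<k. (cmod (d j))\<^sup>2)"
proof -
  have "real k * cmod (d k) = cmod (\<Sum>j=1..k. \<beta> j * d (k - j))"
    by (metis assms norm_mult norm_of_nat)
  also have "\<dots> \<le> (\<Sum>j=1..k. cmod (\<beta> j) * cmod (d (k - j)))"
    by (rule sum_norm_le) (simp add: norm_mult)
  finally have "(real k * cmod (d k))\<^sup>2 \<le> (\<Sum>j=1..k. cmod (\<beta> j) * cmod (d (k - j)))\<^sup>2"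
    by (intro power_mono) auto
  also have "\<dots> \<le> (\<Sum>j=1..k. (cmod (\<beta> j))\<^sup>2) * (\<Sum>j=1..k. (cmod (d (k - j)))\<^sup>2)"
    by (rule Cauchy_Schwarz_ineq_sum)
  also have "(\<Sum>j=1..k. (cmod (d (k - j)))\<^sup>2) = (\<Sum>j<k. (cmod (d j))\<^sup>2)"
    by (rule sum.reindex_bij_witness[of _ "\<lambda>j. k - j" "\<lambda>j. k - j"]) auto
  finally show ?thesis by (simp add: power_mult_distrib)
qed

text \<open>This is the second Lebedev-Milin inequality: exchanging the two summations gives
  \<open>(cmod (\<beta> j))\<^sup>2 - 1\<close> the weight 1/j - 1/(n+1).\<close>

lemma lebedev_milin_sum:
  fixes \<beta> d :: "nat \<Rightarrow> complex"
  assumes "d 0 = 1" "\<And>k. of_nat k * d k = (\<Sum>j=1..k. \<beta> j * d (k - j))"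
  shows "(\<Sum>k<Suc n. (cmod (d k))\<^sup>2)
    \<le> real (Suc n) * exp (\<Sum>m=1..n. (\<Sum>j=1..m. (cmod (\<beta> j))\<^sup>2 - 1) / (real m * (real m + 1)))"
proof (induction n)
  case 0
  then show ?case using assms(1) by simp
next
  case (Suc n)
  define N where "N = real (Suc n)"
  have N: "N > 0" by (simp add: N_def)
  define S where "S = (\<Sum>j=1..Suc n. (cmod (\<beta> j))\<^sup>2)"
  define A where "A = (\<Sum>k<Suc n. (cmod (d k))\<^sup>2)"
  define E where "E = (\<Sum>m=1..n. (\<Sum>j=1..m. (cmod (\<beta> j))\<^sup>2 - 1) / (real m * (real m + 1)))"
  have S: "S \<ge> 0" unfolding S_def by (intro sum_nonneg) auto
  have "(\<Sum>k<Suc (Suc n). (cmod (d k))\<^sup>2) = A + (cmod (d (Suc n)))\<^sup>2"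
    by (simp add: A_def)
  also have "(cmod (d (Suc n)))\<^sup>2 \<le> S * A / N\<^sup>2"
    using exponential_recurrence_coeff_sq[OF assms(2), of "Suc n"] N
    by (simp add: field_simps S_def A_def N_def)
  also have "A + S * A / N\<^sup>2 = (1 + S / N\<^sup>2) * A" by (simp add: algebra_simps)
  also have "\<dots> \<le> (1 + S / N\<^sup>2) * (N * exp E)"
    using Suc.IH S by (intro mult_left_mono) (simp_all add: A_def N_def E_def)
  \<comment> \<open>Once the next leading factor N + 1 is split off, the rest has the form 1 + x,
    and 1 + x \<le> exp x adds exactly the new term of the exponent.\<close>
  also have "\<dots> = (N + 1) * (1 + (S - N) / (N * (N + 1))) * exp E"
  proof -
    have "N + 1 \<noteq> 0" using N by linarith
    then show ?thesis using N by (simp add: divide_simps power2_eq_square) (simp add: algebra_simps)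
  qed
  also have "\<dots> \<le> (N + 1) * exp ((S - N) / (N * (N + 1))) * exp E"
    using N by (intro mult_right_mono mult_left_mono exp_ge_add_one_self) auto
  also have "\<dots> = (N + 1) * exp (E + (S - N) / (N * (N + 1)))"
    by (simp add: exp_add)
  also have "S - N = (\<Sum>j=1..Suc n. (cmod (\<beta> j))\<^sup>2 - 1)"
    by (simp add: S_def N_def sum_subtractf)
  finally show ?case by (simp add: N_def E_def add_ac)
qed

text \<open>The exponent is linear in the quantities \<open>(cmod (\<beta> j))\<^sup>2 - 1\<close>, so that a single rotation can
  make it nonpositive; two separate bounds for the sums would require two different rotations.\<close>

lemma lebedev_milin_two_sums:
  fixes \<beta> d :: "nat \<Rightarrow> complex"
  assumes "d 0 = 1" "\<And>k. of_nat k * d k = (\<Sum>j=1..k. \<beta> j * d (k - j))" "n \<ge> 1"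
  shows "(\<Sum>k<n. (cmod (d k))\<^sup>2) + (\<Sum>k\<le>n. (cmod (d k))\<^sup>2)
    \<le> (2 * real n + 1) * exp (\<Sum>m=1..n. (\<Sum>j=1..m. (cmod (\<beta> j))\<^sup>2 - 1) /
         (real m * (if m < n then real m + 1 else 2 * real n + 1)))"
proof -
  obtain l where l: "n = Suc l" using \<open>n \<ge> 1\<close> by (cases n) auto
  define N where "N = real n"
  have N: "N > 0" using \<open>n \<ge> 1\<close> by (simp add: N_def)
  define S where "S = (\<Sum>j=1..n. (cmod (\<beta> j))\<^sup>2)"
  define A where "A = (\<Sum>k<n. (cmod (d k))\<^sup>2)"
  define E where "E = (\<Sum>m=1..l. (\<Sum>j=1..m. (cmod (\<beta> j))\<^sup>2 - 1) / (real m * (real m + 1)))"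
  have S: "S \<ge> 0" unfolding S_def by (intro sum_nonneg) auto
  have "A + (\<Sum>k\<le>n. (cmod (d k))\<^sup>2) = 2 * A + (cmod (d n))\<^sup>2"
    by (simp add: A_def flip: lessThan_Suc_atMost)
  also have "(cmod (d n))\<^sup>2 \<le> S * A / N\<^sup>2"
    using exponential_recurrence_coeff_sq[OF assms(2), of n] N
    by (simp add: field_simps S_def A_def N_def)
  also have "2 * A + S * A / N\<^sup>2 = (2 + S / N\<^sup>2) * A" by (simp add: algebra_simps)
  also have "\<dots> \<le> (2 + S / N\<^sup>2) * (N * exp E)"
    using lebedev_milin_sum[OF assms(1,2), of l] S
    by (intro mult_left_mono) (simp_all add: A_def N_def E_def l)
  \<comment> \<open>Here the factor split off is 2 N + 1, the total number of terms in the two sums;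
    this is why the last denominator in the exponent differs from the others.\<close>
  also have "\<dots> = (2 * N + 1) * (1 + (S - N) / (N * (2 * N + 1))) * exp E"
  proof -
    have "2 * N + 1 \<noteq> 0" using N by linarith
    then show ?thesis using N by (simp add: divide_simps power2_eq_square) (simp add: algebra_simps)
  qed
  also have "\<dots> \<le> (2 * N + 1) * exp ((S - N) / (N * (2 * N + 1))) * exp E"
    using N by (intro mult_right_mono mult_left_mono exp_ge_add_one_self) auto
  also have "\<dots> = (2 * N + 1) * exp (E + (S - N) / (N * (2 * N + 1)))"
    by (simp add: exp_add)
  also have "S - N = (\<Sum>j=1..n. (cmod (\<beta> j))\<^sup>2 - 1)"
    by (simp add: S_def N_def sum_subtractf)
  also have "E + (\<Sum>j=1..n. (cmod (\<beta> j))\<^sup>2 - 1) / (N * (2 * N + 1)) =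
     (\<Sum>m=1..n. (\<Sum>j=1..m. (cmod (\<beta> j))\<^sup>2 - 1) /
         (real m * (if m < n then real m + 1 else 2 * real n + 1)))"
  proof -
    have "E = (\<Sum>m=1..l. (\<Sum>j=1..m. (cmod (\<beta> j))\<^sup>2 - 1) /
         (real m * (if m < n then real m + 1 else 2 * real n + 1)))"
      unfolding E_def l by (rule sum.cong) auto
    then show ?thesis by (simp add: l N_def)
  qed
  finally show ?thesis by (simp add: A_def N_def)
qed

section \<open>Power series identities in the disc\<close>

lemma holomorphic_deriv_unit_disc [holomorphic_intros]:
  "f holomorphic_on ball 0 1 \<Longrightarrow> deriv f holomorphic_on ball 0 1"
  by (simp add: holomorphic_deriv)

lemma fps_expansion_deriv_unit_disc:
  assumes "f holomorphic_on ball 0 1"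
  shows "fps_expansion (deriv f) 0 = fps_deriv (fps_expansion f 0)"
proof (rule fps_expansion_unique_complex)
  show "deriv f has_fps_expansion fps_expansion (deriv f) 0"
    using assms by (intro has_fps_expansion_fps_expansion[of "ball 0 1"] holomorphic_intros) auto
  show "deriv f has_fps_expansion fps_deriv (fps_expansion f 0)"
    using assms by (intro has_fps_expansion_deriv has_fps_expansion_fps_expansion[of "ball 0 1"]) auto
qed

lemma fps_expansion_mult_unit_disc:
  assumes "f holomorphic_on ball 0 1" "g holomorphic_on ball 0 1"
    and "\<And>z. z \<in> ball 0 1 \<Longrightarrow> h z = f z * g z"
  shows "fps_expansion h 0 = fps_expansion f 0 * fps_expansion g 0"
proof (rule fps_expansion_unique_complex)
  have "h holomorphic_on ball 0 1 \<longleftrightarrow> (\<lambda>z. f z * g z) holomorphic_on ball 0 1"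
    by (rule holomorphic_cong) (use assms(3) in auto)
  then show "h has_fps_expansion fps_expansion h 0"
    using assms by (intro has_fps_expansion_fps_expansion[of "ball 0 1"]) (auto intro: holomorphic_intros)
  have "(\<lambda>z. f z * g z) has_fps_expansion fps_expansion f 0 * fps_expansion g 0"
    using assms by (intro has_fps_expansion_mult has_fps_expansion_fps_expansion[of "ball 0 1"]) auto
  moreover have "\<forall>\<^sub>F z in nhds 0. f z * g z = h z"
    using eventually_nhds_in_open[of "ball 0 1" "0::complex"]
    by (auto elim!: eventually_mono simp: assms(3))
  ultimately show "h has_fps_expansion fps_expansion f 0 * fps_expansion g 0"
    by (simp add: has_fps_expansion_cong[of "\<lambda>z. f z * g z" h])
qed

text \<open>Logarithmic derivatives add: z G'/G = p - 1, and for L = 1 - \<zeta> z with inverse Z,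
  the geometric series, z L'/L = 1 - Z. The product L G thus has z D'/D = p - Z, whose constant term
  vanishes.\<close>

lemma rotated_factor_recurrence:
  fixes G p :: "complex fps" and \<zeta> :: complex
  assumes "fps_X * fps_deriv G = (p - 1) * G" "fps_nth p 0 = 1"
  defines "d \<equiv> fps_nth ((1 - fps_const \<zeta> * fps_X) * G)"
  shows "of_nat k * d k = (\<Sum>j=1..k. (fps_nth p j - \<zeta> ^ j) * d (k - j))"
proof -
  define L where "L = 1 - fps_const \<zeta> * fps_X"
  define Z where "Z = Abs_fps (\<lambda>j. \<zeta> ^ j)"
  have LZ: "L * Z = 1"
  proof (rule fps_ext)
    fix n show "fps_nth (L * Z) n = fps_nth 1 n"
      by (cases n) (simp_all add: L_def Z_def left_diff_distrib mult.assoc)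
  qed
  have "fps_deriv L = - fps_const \<zeta>" by (simp add: L_def)
  then have "fps_X * fps_deriv L = L - L * Z"
    unfolding LZ by (simp add: L_def)
  then have dL: "fps_X * fps_deriv L = - (Z - 1) * L"
    by (simp add: algebra_simps)
  have "fps_X * fps_deriv (L * G) = (fps_X * fps_deriv L) * G + L * (fps_X * fps_deriv G)"
    by (simp add: algebra_simps)
  also have "\<dots> = (p - Z) * (L * G)"
    unfolding dL assms(1) by (simp add: algebra_simps)
  finally have eq: "fps_X * fps_deriv (L * G) = (p - Z) * (L * G)" .
  have X_deriv: "fps_nth (fps_X * fps_deriv H) k = of_nat k * fps_nth H k" for H :: "complex fps"
    by (cases k) simp_all
  have "of_nat k * d k = fps_nth (fps_X * fps_deriv (L * G)) k"
    unfolding X_deriv by (simp add: d_def L_def)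
  also have "\<dots> = (\<Sum>j=0..k. fps_nth (p - Z) j * d (k - j))"
    unfolding eq by (simp add: fps_mult_nth d_def L_def)
  also have "\<dots> = (\<Sum>j=1..k. (fps_nth p j - \<zeta> ^ j) * d (k - j))"
    using assms(2) by (simp add: sum.atLeast_Suc_atMost Z_def)
  finally show ?thesis .
qed

section \<open>Differences of coefficients\<close>

text \<open>The bound is (n+1)^2 - n^2, so it telescopes to the general case.\<close>

lemma successive_coeff_bound:
  assumes "f \<in> class_K" "n \<ge> 1"
  shows "\<bar>real (Suc n) * cmod (taylor_coeff f (Suc n)) - real n * cmod (taylor_coeff f n)\<bar>
           \<le> 2 * real n + 1"
proof -
  obtain g where f: "f \<in> class_A" and g: "convex_function g"
    and Re_fg: "\<And>z. z \<in> unit_disc \<Longrightarrow> Re (deriv f z / deriv g z) > 0"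
    using assms(1) by (auto simp: class_K_def)
  have fh [holomorphic_intros]: "f holomorphic_on ball 0 1"
    and gh [holomorphic_intros]: "g holomorphic_on ball 0 1"
    and g'0: "\<And>z. z \<in> ball 0 1 \<Longrightarrow> deriv g z \<noteq> 0"
    and df0: "deriv f 0 = 1" and dg0: "deriv g 0 = 1"
    using f g by (auto simp: convex_function_def class_A_def taylor_coeff_def fps_expansion_def)
  define pfun where "pfun z = 1 + z * deriv (deriv g) z / deriv g z" for z
  define Pfun where "Pfun z = deriv f z / deriv g z" for z
  have pfun: "pfun holomorphic_on ball 0 1" "pfun 0 = 1" "\<And>z. z \<in> ball 0 1 \<Longrightarrow> Re (pfun z) \<ge> 0"
    using g g'0 unfolding pfun_def
    by (auto intro!: holomorphic_intros simp: convex_function_def less_imp_le)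
  have Pfun: "Pfun holomorphic_on ball 0 1" "Pfun 0 = 1" "\<And>z. z \<in> ball 0 1 \<Longrightarrow> Re (Pfun z) \<ge> 0"
    using Re_fg g'0 df0 dg0 unfolding Pfun_def
    by (auto intro!: holomorphic_intros simp: less_imp_le)
  define G where "G = fps_expansion (deriv g) 0"
  define p where "p = fps_expansion pfun 0"
  define P where "P = fps_expansion Pfun 0"
  have p0: "fps_nth p 0 = 1" and P0: "fps_nth P 0 = 1" and G0: "fps_nth G 0 = 1"
    using pfun(2) Pfun(2) dg0 by (simp_all add: p_def P_def G_def fps_expansion_def)
  \<comment> \<open>Both sides of z g'' = (\<open>pfun\<close> - 1) g' are expanded, which yields
    the equation for \<open>G\<close>.\<close>
  have "fps_expansion (\<lambda>z. z * deriv (deriv g) z) 0 = fps_expansion (\<lambda>z. z) 0 * fps_deriv G"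
    unfolding G_def by (subst fps_expansion_deriv_unit_disc [symmetric])
      (intro holomorphic_intros fps_expansion_mult_unit_disc refl)+
  moreover have "fps_expansion (\<lambda>z. z) 0 = (fps_X :: complex fps)"
    by (rule fps_expansion_unique_complex[where f = "\<lambda>z. z"])
       (auto intro!: has_fps_expansion_fps_expansion[of UNIV] has_fps_expansion_fps_X)
  moreover have "fps_expansion (\<lambda>z. z * deriv (deriv g) z) 0 = fps_expansion (\<lambda>z. pfun z - 1) 0 * G"
    unfolding G_def using g'0
    by (intro fps_expansion_mult_unit_disc holomorphic_intros pfun(1)) (auto simp: pfun_def)
  moreover have "fps_expansion (\<lambda>z. pfun z - 1) 0 = p - 1"
  proof (rule fps_expansion_unique_complex)
    show "(\<lambda>z. pfun z - 1) has_fps_expansion fps_expansion (\<lambda>z. pfun z - 1) 0"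
      using pfun(1) by (intro has_fps_expansion_fps_expansion[of "ball 0 1"] holomorphic_intros) auto
    show "(\<lambda>z. pfun z - 1) has_fps_expansion p - 1"
      unfolding p_def using pfun(1)
      by (intro has_fps_expansion_diff has_fps_expansion_1 has_fps_expansion_fps_expansion[of "ball 0 1"]) auto
  qed
  ultimately have ode: "fps_X * fps_deriv G = (p - 1) * G" by simp
  have f'_eq: "fps_deriv (fps_expansion f 0) = G * P"
    unfolding G_def P_def fps_expansion_deriv_unit_disc[OF fh, symmetric]
    using g'0 by (intro fps_expansion_mult_unit_disc holomorphic_intros Pfun(1)) (auto simp: Pfun_def)
  define w where "w m = real m * (if m < n then real m + 1 else 2 * real n + 1)" for m
  \<comment> \<open>The weight of the jth square in the exponent after the double sum is rearranged
    by j.\<close>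
  define c where "c j = (\<Sum>m=1..n. if j \<le> m then 1 / w m else 0)" for j
  obtain \<zeta> where \<zeta>: "cmod \<zeta> = 1" "(\<Sum>j=1..n. c j * ((cmod (fps_nth p j - \<zeta> ^ j))\<^sup>2 - 1)) \<le> 0"
    using exists_rotation_nonpos[OF pfun(1,3,2)] unfolding p_def by blast
  define x where "x j = (cmod (fps_nth p j - \<zeta> ^ j))\<^sup>2 - 1" for j
  define D where "D = (1 - fps_const \<zeta> * fps_X) * G"
  define d where "d = fps_nth D"
  have exponent: "(\<Sum>m=1..n. (\<Sum>j=1..m. x j) / w m) = (\<Sum>j=1..n. c j * x j)"
  proof -
    have "(\<Sum>j=1..m. x j) / w m = (\<Sum>j=1..n. if j \<le> m then x j / w m else 0)" if "m \<in> {1..n}" for m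
    proof -
      have "{j \<in> {1..n}. j \<le> m} = {1..m}" using that by auto
      then show ?thesis by (simp add: sum_divide_distrib flip: sum.inter_filter)
    qed
    then have "(\<Sum>m=1..n. (\<Sum>j=1..m. x j) / w m) = (\<Sum>m=1..n. \<Sum>j=1..n. if j \<le> m then x j / w m else 0)"
      by (rule sum.cong[OF refl])
    also have "\<dots> = (\<Sum>j=1..n. \<Sum>m=1..n. if j \<le> m then x j / w m else 0)"
      by (rule sum.swap)
    also have "\<dots> = (\<Sum>j=1..n. c j * x j)"
      unfolding c_def sum_distrib_right by (intro sum.cong refl) auto
    finally show ?thesis .
  qed
  have d0: "d 0 = 1" by (simp add: d_def D_def G0)
  have "(\<Sum>k<n. (cmod (d k))\<^sup>2) + (\<Sum>k\<le>n. (cmod (d k))\<^sup>2)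
    \<le> (2 * real n + 1) * exp (\<Sum>m=1..n. (\<Sum>j=1..m. x j) / w m)"
    unfolding x_def w_def
    using d0 rotated_factor_recurrence[OF ode p0] \<open>n \<ge> 1\<close>
    by (intro lebedev_milin_two_sums) (auto simp: d_def D_def)
  also have "\<dots> \<le> (2 * real n + 1) * 1"
    unfolding exponent using \<zeta>(2) by (intro mult_left_mono) (auto simp: x_def)
  finally have sq: "(\<Sum>k<n. (cmod (d k))\<^sup>2) + (\<Sum>k\<le>n. (cmod (d k))\<^sup>2) \<le> 2 * real n + 1" by simp
  \<comment> \<open>The two sums have n + (n + 1) = 2n + 1 terms together, so a bound 2n + 1 for the
    squares passes to the moduli without loss.\<close>
  have AM_GM: "cmod u \<le> (1 + (cmod u)\<^sup>2) / 2" for u :: complex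
    using sum_squares_bound[of "cmod u" 1] by simp
  have "(\<Sum>k<n. cmod (d k)) \<le> (\<Sum>k<n. (1 + (cmod (d k))\<^sup>2) / 2)"
    by (intro sum_mono AM_GM)
  moreover have "(\<Sum>k\<le>n. cmod (d k)) \<le> (\<Sum>k\<le>n. (1 + (cmod (d k))\<^sup>2) / 2)"
    by (intro sum_mono AM_GM)
  ultimately have lin: "(\<Sum>k<n. cmod (d k)) + (\<Sum>k\<le>n. cmod (d k)) \<le> 2 * real n + 1"
    using sq by (simp add: sum.distrib flip: sum_divide_distrib)
  define b where "b j = of_nat j * taylor_coeff f j" for j
  have b_Suc: "fps_nth (G * P) j = b (Suc j)" for j
    unfolding f'_eq[symmetric] by (simp add: b_def taylor_coeff_def)
  have "b (Suc n) - \<zeta> * b n = fps_nth (D * P) n"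
  proof -
    \<comment> \<open>The jth coefficient of f' is \<open>b (Suc j)\<close>; multiplying by
      \<open>fps_X\<close> shifts this to \<open>b n\<close> at index n, provided n is
      positive.\<close>
    obtain l where l: "n = Suc l" using \<open>n \<ge> 1\<close> by (cases n) auto
    have "D * P = G * P - fps_const \<zeta> * (fps_X * (G * P))"
      by (simp add: D_def algebra_simps)
    then show ?thesis by (simp only: fps_sub_nth b_Suc) (simp add: l b_Suc)
  qed
  also have "\<dots> = (\<Sum>k\<le>n. d k * fps_nth P (n - k))"
    by (simp add: fps_mult_nth d_def atMost_atLeast0)
  \<comment> \<open>The last term carries \<open>P\<close> at index 0, which is 1, and avoids the
    factor 2. The modulus of \<open>d n\<close> is thus counted once and the earlier ones twice, as
    in the sum of the two sums.\<close>
  also have "\<dots> = (\<Sum>k<n. d k * fps_nth P (n - k)) + d n"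
    by (simp add: P0 flip: lessThan_Suc_atMost)
  finally have "cmod (b (Suc n) - \<zeta> * b n) \<le> cmod (\<Sum>k<n. d k * fps_nth P (n - k)) + cmod (d n)"
    by (simp add: norm_triangle_ineq)
  also have "cmod (\<Sum>k<n. d k * fps_nth P (n - k)) \<le> (\<Sum>k<n. cmod (d k) * 2)"
  proof (rule sum_norm_le)
    fix k assume "k \<in> {..<n}"
    then show "cmod (d k * fps_nth P (n - k)) \<le> cmod (d k) * 2"
      unfolding norm_mult P_def
      by (intro mult_left_mono caratheodory_coeff_bound Pfun) auto
  qed
  also have "(\<Sum>k<n. cmod (d k) * 2) + cmod (d n) \<le> 2 * real n + 1"
    using lin by (simp flip: sum_distrib_right lessThan_Suc_atMost)
  finally have "cmod (b (Suc n) - \<zeta> * b n) \<le> 2 * real n + 1" by simp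
  \<comment> \<open>Because |\<zeta>| = 1, the rotation does not affect the difference of
    moduli.\<close>
  moreover have "\<bar>cmod (b (Suc n)) - cmod (b n)\<bar> \<le> cmod (b (Suc n) - \<zeta> * b n)"
    using norm_triangle_ineq3[of "b (Suc n)" "\<zeta> * b n"] \<zeta>(1) by (simp add: norm_mult)
  ultimately show ?thesis
    by (simp add: b_def norm_mult del: of_nat_Suc)
qed

theorem theorem3p1:
  fixes f :: "complex \<Rightarrow> complex" and k m :: nat
  assumes "f \<in> class_K" and "k \<ge> 1" and "m \<ge> 1"
  shows "\<bar>real k * cmod (taylor_coeff f k) - real m * cmod (taylor_coeff f m)\<bar>
           \<le> \<bar>(real k)\<^sup>2 - (real m)\<^sup>2\<bar>"
proof -
  define B where "B j = real j * cmod (taylor_coeff f j)" for j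
  have ordered: "\<bar>B j - B i\<bar> \<le> (real j)\<^sup>2 - (real i)\<^sup>2" if "i \<ge> 1" "i \<le> j" for i j
    using \<open>i \<le> j\<close>
  proof (induction j rule: dec_induct)
    case (step n)
    have "\<bar>B (Suc n) - B n\<bar> \<le> 2 * real n + 1"
      using successive_coeff_bound[OF assms(1), of n] step that by (simp add: B_def)
    then show ?case using step by (simp add: power2_eq_square algebra_simps)
  qed simp
  show ?thesis
    using ordered[of k m] ordered[of m k] assms(2,3) nat_le_linear[of k m] by (auto simp: B_def)
qed

end
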